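(* Let $n\ge1$. For every $x\in[0,\infty)^n$ and all integers $k,r\ge1$, $$\nabla F_{k,r}(x)\in\overline{C_\Psi(x)},$$ where $\overline{C_\Psi(x)}$ is the positive cone generated by $\{\nabla\Psi_\lambda(x)\}_{\lambda>0}$, with $\Psi_\lambda(x)=\sum_{i=1}^n\left(\min(x_i,\lambda)+\lambda\log_+(x_i/\lambda)\right)$ for $x\in\mathbb{R}^n$, $\lambda>0$.
   Context: $\log_+(s)=0$ for $s\in(-\infty,1]$ and $\log_+(s)=\log s$ for $s\ge1$; each $\Psi_\lambda$ is $C^1$ on $\mathbb{R}^n$. $C_\Psi(x)=\{c_1\nabla\Psi_{\lambda_1}(x)+\dots+c_m\nabla\Psi_{\lambda_m}(x): m\in\mathbb{N},\ c_i\ge0,\ \lambda_i>0\}$, and $\overline{C_\Psi(x)}$ (the positive cone) is its closure in $\mathbb{R}^n$. For integers $k,r\ge 1$, $$F_{k,r}(x_1,\dots,x_n)=\sum_{k_1+\dots+k_n=k,\ \max_i k_i\le r}\ \prod_{i=1}^n\frac{x_i^{k_i}}{k_i!},$$ where the $k_i$ range over nonnegative integers. *)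

theory Defs
  imports "HOL-Analysis.Analysis"
begin

definition gradient :: "('a::real_inner \<Rightarrow> real) \<Rightarrow> 'a \<Rightarrow> 'a" where
  "gradient f x = (THE D. GDERIV f x :> D)"

lemma gradient_eqI:
  assumes "GDERIV f x :> D"
  shows "gradient f x = D"
  unfolding gradient_def
proof (rule the_equality)
  fix E assume "GDERIV f x :> E"
  with assms have "(\<lambda>h. h \<bullet> E) = (\<lambda>h. h \<bullet> D)"
    unfolding gderiv_def by (rule has_derivative_unique[rotated])
  then have "h \<bullet> E = h \<bullet> D" for h
    by (rule fun_cong)
  then show "E = D"
    by (metis vector_eq_rdot inner_commute)
qed (fact assms)

definition log_plus :: "real \<Rightarrow> real" where
  "log_plus s = (if s \<le> 1 then 0 else ln s)"

definition Psi :: "real \<Rightarrow> real ^ 'n \<Rightarrow> real" where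
  "Psi l x = (\<Sum>i\<in>UNIV. min (x $ i) l + l * log_plus (x $ i / l))"

definition C_Psi :: "real ^ 'n \<Rightarrow> (real ^ 'n) set" where
  "C_Psi x = {\<Sum>i=1..m. c i *\<^sub>R gradient (Psi (l i)) x | (m :: nat) c l.
     \<forall>i\<in>{1..m}. c i \<ge> 0 \<and> l i > 0}"

definition F :: "nat \<Rightarrow> nat \<Rightarrow> real ^ 'n \<Rightarrow> real" where
  "F k r x = (\<Sum>\<kappa> | (\<Sum>i\<in>UNIV. \<kappa> i) = k \<and> Max (range \<kappa>) \<le> r.
     \<Prod>i\<in>UNIV. (x $ i) ^ \<kappa> i / fact (\<kappa> i))"

text \<open>The sum defining \<^const>\<open>F\<close> ranges over a finite set.\<close>

lemma finite_F_indices: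
  "finite {\<kappa> :: 'n::finite \<Rightarrow> nat. (\<Sum>i\<in>UNIV. \<kappa> i) = k \<and> Max (range \<kappa>) \<le> r}"
proof (rule finite_subset)
  show "finite (UNIV \<rightarrow>\<^sub>E {..r} :: ('n \<Rightarrow> nat) set)"
    by (intro finite_PiE) auto
qed auto

text \<open>\<^const>\<open>Psi\<close> (for positive parameter) and \<^const>\<open>F\<close> are differentiable everywhere,
  so \<^const>\<open>gradient\<close> is well defined for both.\<close>

lemma GDERIV_gradient:
  fixes f :: "'a::euclidean_space \<Rightarrow> real"
  assumes "f differentiable (at x)"
  shows "GDERIV f x :> gradient f x"
proof -
  obtain f' where f': "(f has_derivative f') (at x)"
    using assms unfolding differentiable_def by blast
  interpret linear f'
    using f' by (rule has_derivative_linear)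
  have "f' h = h \<bullet> (\<Sum>b\<in>Basis. f' b *\<^sub>R b)" for h
  proof -
    have "f' h = f' (\<Sum>b\<in>Basis. (h \<bullet> b) *\<^sub>R b)"
      by (simp add: euclidean_representation)
    also have "\<dots> = (\<Sum>b\<in>Basis. (h \<bullet> b) * f' b)"
      by (simp add: sum scaleR)
    finally show ?thesis
      by (simp add: inner_sum_right mult.commute)
  qed
  then have "f' = (\<lambda>h. h \<bullet> (\<Sum>b\<in>Basis. f' b *\<^sub>R b))"
    by (rule ext)
  with f' have "GDERIV f x :> (\<Sum>b\<in>Basis. f' b *\<^sub>R b)"
    unfolding gderiv_def by simp
  from this gradient_eqI[OF this] show ?thesis
    by simp
qed

lemma Psi_summand_has_derivative:
  fixes l s :: real
  assumes "l > 0"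
  shows "((\<lambda>s. min s l + l * log_plus (s / l)) has_field_derivative
    (if s \<le> l then 1 else l / s)) (at s)"
proof -
  have "((\<lambda>s. if s \<in> {..l} then s else l + l * ln (s / l)) has_vector_derivative
      (if s \<in> {..l} then 1 else l / s)) (at s within UNIV)"
  proof (rule has_vector_derivative_If_within_closures[where S = "{..l}" and T = "{l<..}"
        and f = "\<lambda>s. s" and f' = "\<lambda>_. 1"
        and g = "\<lambda>s. l + l * ln (s / l)" and g' = "\<lambda>s. l / s" and x = s and u = UNIV])
    show "((\<lambda>s. l + l * ln (s / l)) has_vector_derivative l / s)
        (at s within {l<..} \<union> closure {..l} \<inter> closure {l<..})"
      if "s \<in> {l<..} \<union> closure {..l} \<inter> closure {l<..}"
    proof -
      have "s > 0" using that assms by auto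
      then have "((\<lambda>s. l + l * ln (s / l)) has_real_derivative l / s) (at s)"
        using assms by (auto intro!: derivative_eq_intros)
      then show ?thesis
        by (metis has_field_derivative_at_within has_real_derivative_iff_has_vector_derivative)
    qed
  qed (use assms in \<open>auto\<close>)
  moreover have "(\<lambda>s. if s \<in> {..l} then s else l + l * ln (s / l)) =
      (\<lambda>s. min s l + l * log_plus (s / l))"
    using assms by (auto simp: fun_eq_iff log_plus_def field_simps)
  ultimately show ?thesis
    by (simp add: has_real_derivative_iff_has_vector_derivative)
qed

lemma differentiable_Psi:
  assumes "l > 0"
  shows "Psi l differentiable (at x)"
proof -
  have "(\<lambda>x. min (x $ i) l + l * log_plus (x $ i / l)) differentiable (at x)" for x :: "real ^ 'n" and i
  proof -
    have "(((\<lambda>s. min s l + l * log_plus (s / l)) \<circ> (\<lambda>x. x $ i)) has_derivative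
        ((*) (if x $ i \<le> l then 1 else l / x $ i)) \<circ> (\<lambda>h. h $ i)) (at x)"
      by (intro diff_chain_at bounded_linear_imp_has_derivative bounded_linear_vec_nth
        Psi_summand_has_derivative[OF assms, unfolded has_field_derivative_def])
    then show ?thesis
      by (auto simp: o_def differentiable_def)
  qed
  then have "(\<lambda>x. Psi l x) differentiable (at x)"
    unfolding Psi_def by (intro differentiable_sum) auto
  then show ?thesis by simp
qed

lemma differentiable_F:
  "F k r differentiable (at x)"
proof -
  have *: "(\<lambda>x. (x $ i) ^ j / fact j) differentiable (at x)" for x :: "real ^ 'n" and i j
    by (intro differentiable_divide differentiable_power differentiable_const
      bounded_linear_imp_differentiable bounded_linear_vec_nth) auto
  have prod: "(\<lambda>x. \<Prod>i\<in>UNIV. (x $ i) ^ \<kappa> i / fact (\<kappa> i)) differentiable (at x)"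
    for \<kappa> and x :: "real ^ 'n"
  proof -
    define D where "D = (\<lambda>i. SOME D. ((\<lambda>x. (x $ i) ^ \<kappa> i / fact (\<kappa> i)) has_derivative D) (at x))"
    have D: "((\<lambda>x. (x $ i) ^ \<kappa> i / fact (\<kappa> i)) has_derivative D i) (at x)" for i
      unfolding D_def by (rule someI_ex[OF *[unfolded differentiable_def]])
    show ?thesis
      unfolding differentiable_def
      by (rule exI, rule has_derivative_prod[where f = "\<lambda>i x. (x $ i) ^ \<kappa> i / fact (\<kappa> i)"
            and f' = D]) (rule D)
  qed
  show ?thesis
    unfolding F_def[abs_def] by (rule differentiable_sum[OF finite_F_indices]) (intro ballI prod)
qed

end

theory Submission
  imports Defs
begin

text \<open>
  The \<open>i\<close>-th component of \<open>\<nabla>\<Psi>\<^sub>\<lambda>(x)\<close> is \<open>min(1, \<lambda>/x\<^sub>i)\<close>, so after multiplication by \<open>x\<^sub>i\<close> the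
  generators of the cone are the truncations \<open>s \<mapsto> min(s, \<lambda>)\<close> sampled at the coordinates of \<open>x\<close>.
  Nonnegative combinations of truncations sample exactly the functions on the finite set
  \<open>{0} \<union> {x\<^sub>1, ..., x\<^sub>n}\<close> that vanish at \<open>0\<close>, are nondecreasing and are concave
  (\<open>concave_as_sum_of_truncations\<close>). A coordinate with \<open>x\<^sub>i = 0\<close> sees the total mass of the
  combination, and this mass can be enlarged there at will: as \<open>\<lambda>\<close> tends to \<open>0\<close>,
  \<open>\<nabla>\<Psi>\<^sub>\<lambda>(x)\<close> tends to the indicator vector of the vanishing coordinates. This limit is the reason for the
  closure (\<open>in_closure_C_Psi\<close>).

  It remains to see that \<open>x\<^sub>i \<partial>\<^sub>iF\<close> is such a function of \<open>x\<^sub>i\<close>. Let \<open>f\<^sub>s(t)\<close> be the exponential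
  series of \<open>s t\<close> cut off after degree \<open>r\<close>. Then \<open>F\<^bsub>k,r\<^esub>(x)\<close> is the coefficient of \<open>t\<^sup>k\<close> in
  \<open>P = \<Prod>\<^sub>i f\<^bsub>x\<^sub>i\<^esub>\<close>, and since differentiating a truncated exponential only loses its top term,
  \<open>\<partial>\<^sub>iF\<close> is the coefficient of \<open>t\<^bsup>k-1\<^esup>\<close> in \<open>P (1 - (s t)\<^sup>r / (r! f\<^sub>s))\<close> at \<open>s = x\<^sub>i\<close>
  (\<open>gradient_F\<close>). Consequently \<open>x\<^sub>i \<partial>\<^sub>iF\<close> is the coefficient of \<open>t\<^bsup>k-1\<^esup>\<close> in
  \<open>P f\<^sub>s' / f\<^sub>s\<close>, the prime denoting \<open>d/dt\<close> (\<open>mult_slope_at\<close>). The first formula also shows that the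
  derivative at a vanishing coordinate is at least the total mass, which is the value of the formula at the
  smallest positive coordinate (\<open>slope_at_le_slope_at_0\<close>).

  To compare this expression at two or three points \<open>a < b < c\<close> of \<open>{0} \<union> {x\<^sub>1, ..., x\<^sub>n}\<close>, split the
  factors \<open>f\<^sub>a, f\<^sub>b, f\<^sub>c\<close> off \<open>P\<close>; the cofactor has nonnegative coefficients. Monotonicity
  becomes the nonnegativity of the coefficients of the Wronskian \<open>f\<^sub>a f\<^sub>b' - f\<^sub>b f\<^sub>a'\<close>, in which the
  exponents \<open>p < q\<close> contribute \<open>(q - p)(a\<^sup>p b\<^sup>q - a\<^sup>q b\<^sup>p)/(p! q!) \<ge> 0\<close>. Concavity becomes a similar
  statement in three variables, in which the contributions are \<open>(q - p)/(p! q! r!)\<close> times the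
  generalized Vandermonde determinant of \<open>a, b, c\<close> with exponents \<open>p < q < r + 1\<close>
  (\<open>trunc_exp_concavity\<close>, \<open>generalized_vandermonde_nonneg\<close>).
\<close>

section \<open>Concave functions on finitely many points\<close>

text \<open>Induction on the largest point \<open>y\<close>: if \<open>\<sigma>\<close> is the slope of \<open>h\<close> on the last interval, then
  subtracting \<open>\<sigma> min(s, y)\<close> makes the function flat there. Concavity says that no earlier slope is below
  \<open>\<sigma>\<close>, so what remains is still nondecreasing on the smaller set, and flatness means that the truncations
  found for the smaller set also give the right value at \<open>y\<close>.\<close>

lemma concave_as_sum_of_truncations:
  fixes h :: "real \<Rightarrow> real"
  assumes "finite Y" and "\<And>y. y \<in> Y \<Longrightarrow> 0 < y" and "h 0 = 0"
    and "\<And>a b. a \<in> insert 0 Y \<Longrightarrow> b \<in> insert 0 Y \<Longrightarrow> a < b \<Longrightarrow> h a \<le> h b"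
    and "\<And>a b c. a \<in> insert 0 Y \<Longrightarrow> b \<in> insert 0 Y \<Longrightarrow> c \<in> insert 0 Y \<Longrightarrow> a < b \<Longrightarrow> b < c \<Longrightarrow>
      (c - b) * h a + (b - a) * h c \<le> (c - a) * h b"
  shows "\<exists>c. (\<forall>y\<in>Y. 0 \<le> c y) \<and> (\<forall>s\<in>Y. h s = (\<Sum>y\<in>Y. c y * min s y))"
  using assms
proof (induction Y arbitrary: h rule: finite_linorder_max_induct)
  case empty
  then show ?case by simp
next
  case (insert y A)
  note pos = insert.prems(1) and h0 = insert.prems(2) and mono = insert.prems(3)
    and conc = insert.prems(4)
  define m where "m = Max (insert 0 A)"
  have m: "m \<in> insert 0 A" and m_ub: "\<And>a. a \<in> insert 0 A \<Longrightarrow> a \<le> m"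
    unfolding m_def using insert.hyps(1) by (auto intro: Max_in simp del: Max_insert insert_iff)
  have my: "m < y" using m insert.hyps pos by auto
  \<comment> \<open>If only \<open>y\<close> is left, then \<open>m = 0\<close>, which is why \<open>0\<close> is among the points.\<close>
  define \<sigma> where "\<sigma> = (h y - h m) / (y - m)"
  have hy: "h y = h m + \<sigma> * (y - m)" using my by (simp add: \<sigma>_def)
  have \<sigma>: "0 \<le> \<sigma>" unfolding \<sigma>_def using mono[of m y] m my by auto
  have last_slope: "\<sigma> * (y - b) \<le> h y - h b" if b: "b \<in> insert 0 A" for b
  proof (cases "b = m")
    case True
    then show ?thesis using hy by simp
  next
    case False
    with b m_ub have "b < m" by force
    then have "(y - m) * h b + (m - b) * h y \<le> (y - b) * h m"
      using conc[of b m y] b m my by auto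
    then have "(y - m) * (h b + \<sigma> * (m - b)) \<le> (y - m) * h m"
      unfolding hy by (simp add: algebra_simps)
    then have "h b + \<sigma> * (m - b) \<le> h m"
      using my by (simp add: mult_le_cancel_left)
    then show ?thesis unfolding hy by (simp add: algebra_simps)
  qed
  have slope: "\<sigma> * (b - a) \<le> h b - h a" if ab: "a \<in> insert 0 A" "b \<in> insert 0 A" "a < b" for a b
  proof -
    have b_y: "b < y" using ab insert.hyps pos by auto
    have "(b - a) * (\<sigma> * (y - b)) \<le> (b - a) * (h y - h b)"
      using last_slope[OF ab(2)] ab(3) by (intro mult_left_mono) auto
    also have "\<dots> \<le> (y - b) * (h b - h a)"
      using conc[of a b y] ab b_y by (auto simp: algebra_simps)
    finally have "(y - b) * (\<sigma> * (b - a)) \<le> (y - b) * (h b - h a)"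
      by (simp add: algebra_simps)
    then show ?thesis using b_y by (simp add: mult_le_cancel_left)
  qed
  have "\<exists>c. (\<forall>y\<in>A. 0 \<le> c y) \<and> (\<forall>s\<in>A. h s - \<sigma> * s = (\<Sum>y\<in>A. c y * min s y))"
  proof (rule insert.IH)
    fix a b assume "a \<in> insert 0 A" "b \<in> insert 0 A" "a < b"
    from slope[OF this] show "h a - \<sigma> * a \<le> h b - \<sigma> * b" by (simp add: algebra_simps)
  next
    fix a b c assume "a \<in> insert 0 A" "b \<in> insert 0 A" "c \<in> insert 0 A" "a < b" "b < c"
    then have "(c - b) * h a + (b - a) * h c \<le> (c - a) * h b" by (intro conc) auto
    then show "(c - b) * (h a - \<sigma> * a) + (b - a) * (h c - \<sigma> * c) \<le> (c - a) * (h b - \<sigma> * b)"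
      by (simp add: algebra_simps)
  qed (use pos h0 in auto)
  then obtain c where c: "\<And>y. y \<in> A \<Longrightarrow> 0 \<le> c y"
    and hc: "\<And>s. s \<in> A \<Longrightarrow> h s - \<sigma> * s = (\<Sum>y\<in>A. c y * min s y)" by blast
  have hm: "h m - \<sigma> * m = (\<Sum>y\<in>A. c y * min m y)"
  proof (cases "m \<in> A")
    case False
    with m have [simp]: "m = 0" by simp
    have "(\<Sum>y\<in>A. c y * min 0 y) = 0"
      using pos by (intro sum.neutral) (auto simp: min_def less_imp_le)
    then show ?thesis using h0 by simp
  qed (rule hc)
  define d where "d = c(y := \<sigma>)"
  have y: "y \<notin> A" using insert.hyps by auto
  have split: "(\<Sum>z\<in>insert y A. d z * min s z) = \<sigma> * min s y + (\<Sum>z\<in>A. c z * min s z)" for s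
    using y insert.hyps(1) by (simp add: d_def) (intro sum.cong; auto)
  show ?case
  proof (intro exI[of _ d] conjI ballI)
    fix z assume "z \<in> insert y A"
    then show "0 \<le> d z" using c \<sigma> by (auto simp: d_def)
  next
    fix s assume s: "s \<in> insert y A"
    show "h s = (\<Sum>z\<in>insert y A. d z * min s z)"
    proof (cases "s = y")
      case True
      have "(\<Sum>z\<in>A. c z * min y z) = (\<Sum>z\<in>A. c z * min m z)"
        using m_ub[OF insertI2] insert.hyps by (intro sum.cong) (auto simp: min_absorb2 less_imp_le)
      then show ?thesis unfolding split True using hm hy by (simp add: algebra_simps)
    next
      case False
      then show ?thesis unfolding split using s hc[of s] insert.hyps by (force simp: min_def)
    qed
  qed
qed

section \<open>The gradients of the generators and the cone\<close>

lemma GDERIV_vec_sum: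
  fixes g :: "'n::finite \<Rightarrow> real \<Rightarrow> real" and x :: "real ^ 'n"
  assumes "\<And>i. (g i has_field_derivative d i) (at (x $ i))"
  shows "GDERIV (\<lambda>x. \<Sum>i\<in>UNIV. g i (x $ i)) x :> (\<chi> i. d i)"
proof -
  have "((\<lambda>x. g i (x $ i)) has_derivative (\<lambda>h. d i * h $ i)) (at x)" for i
    using diff_chain_at[OF bounded_linear_imp_has_derivative[OF bounded_linear_vec_nth[of i], of "at x"]
        assms[of i, unfolded has_field_derivative_def]]
    by (simp add: o_def)
  then have "((\<lambda>x. \<Sum>i\<in>UNIV. g i (x $ i)) has_derivative (\<lambda>h. \<Sum>i\<in>UNIV. d i * h $ i)) (at x)"
    by (intro has_derivative_sum)
  then show ?thesis
    by (simp add: gderiv_def inner_vec_def mult.commute)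
qed

lemma gradient_Psi:
  fixes x :: "real ^ 'n"
  assumes "0 < l"
  shows "gradient (Psi l) x = (\<chi> i. if x $ i \<le> l then 1 else l / x $ i)"
  using GDERIV_vec_sum[OF Psi_summand_has_derivative[OF assms], of x]
  by (intro gradient_eqI) (simp add: Psi_def[abs_def])

lemma sum_in_C_Psi:
  assumes "finite Y" and "\<And>y. y \<in> Y \<Longrightarrow> 0 < y" and "\<And>y. y \<in> Y \<Longrightarrow> 0 \<le> c y"
  shows "(\<Sum>y\<in>Y. c y *\<^sub>R gradient (Psi y) x) \<in> C_Psi x"
proof -
  obtain l where l: "bij_betw l {1..card Y} Y"
    using ex_bij_betw_nat_finite_1[OF assms(1)] by blast
  have "(\<Sum>y\<in>Y. c y *\<^sub>R gradient (Psi y) x) =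
      (\<Sum>i=1..card Y. c (l i) *\<^sub>R gradient (Psi (l i)) x)"
    by (rule sum.reindex_bij_betw[OF l, symmetric])
  moreover have "\<forall>i\<in>{1..card Y}. c (l i) \<ge> 0 \<and> l i > 0"
    using bij_betwE[OF l] assms by blast
  ultimately show ?thesis
    unfolding C_Psi_def by (intro CollectI exI[of _ "card Y"] exI[of _ "\<lambda>i. c (l i)"] exI[of _ l]) auto
qed

text \<open>The combination given by \<open>c\<close> matches \<open>v\<close> at the positive coordinates and falls short by \<open>d\<close> at
  the zero ones. Adding \<open>d \<nabla>\<Psi>\<^sub>\<epsilon>(x)\<close> with \<open>\<epsilon> \<rightarrow> 0\<close> closes the gap: at a zero coordinate it contributes
  \<open>d\<close>, at a positive one \<open>d \<epsilon>/x\<^sub>i \<rightarrow> 0\<close>.\<close>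

lemma in_closure_C_Psi:
  fixes x v :: "real ^ 'n"
  assumes x: "\<And>i. 0 \<le> x $ i"
    and Y: "finite Y" "\<And>y. y \<in> Y \<Longrightarrow> 0 < y" "\<And>y. y \<in> Y \<Longrightarrow> 0 \<le> c y"
    and v: "\<And>i. 0 < x $ i \<Longrightarrow> x $ i * v $ i = (\<Sum>y\<in>Y. c y * min (x $ i) y)"
    and v0: "\<And>i. x $ i = 0 \<Longrightarrow> v $ i = (\<Sum>y\<in>Y. c y) + d" and d: "0 \<le> d"
  shows "v \<in> closure (C_Psi x)"
proof -
  define u where "u n = (\<Sum>y\<in>Y. c y *\<^sub>R gradient (Psi y) x)
    + d *\<^sub>R gradient (Psi (inverse (Suc n))) x" for n :: nat
  have "u n \<in> C_Psi x" for n
  proof -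
    define e where "e = inverse (real (Suc n))"
    have e: "0 < e" by (simp add: e_def)
    \<comment> \<open>\<open>e\<close> may happen to lie in \<open>Y\<close>, in which case the two coefficients add up.\<close>
    define c' where "c' y = (if y \<in> Y then c y else 0) + (if y = e then d else 0)" for y
    have "(\<Sum>y\<in>insert e Y. c' y *\<^sub>R gradient (Psi y) x) \<in> C_Psi x"
      using Y d e by (intro sum_in_C_Psi) (auto simp: c'_def)
    also have "(\<Sum>y\<in>insert e Y. c' y *\<^sub>R gradient (Psi y) x) =
      (\<Sum>y\<in>insert e Y. (if y \<in> Y then c y else 0) *\<^sub>R gradient (Psi y) x) +
      (\<Sum>y\<in>insert e Y. (if y = e then d else 0) *\<^sub>R gradient (Psi y) x)"
      by (simp add: c'_def scaleR_add_left sum.distrib del: sum.insert)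
    also have "(\<Sum>y\<in>insert e Y. (if y \<in> Y then c y else 0) *\<^sub>R gradient (Psi y) x) =
        (\<Sum>y\<in>Y. c y *\<^sub>R gradient (Psi y) x)"
      using Y(1) by (intro sum.mono_neutral_cong_right) auto
    also have "(\<Sum>y\<in>insert e Y. (if y = e then d else 0) *\<^sub>R gradient (Psi y) x) =
        d *\<^sub>R gradient (Psi e) x"
      using Y(1) by (subst sum.mono_neutral_cong_right[of _ "{e}" _ "\<lambda>y. d *\<^sub>R gradient (Psi y) x"]) auto
    finally show ?thesis by (simp add: u_def e_def)
  qed
  moreover have "u \<longlonglongrightarrow> v"
  proof (rule vec_tendstoI)
    fix i
    have u: "u n $ i = (\<Sum>y\<in>Y. c y * (if x $ i \<le> y then 1 else y / x $ i))
        + d * (if x $ i \<le> inverse (Suc n) then 1 else inverse (Suc n) / x $ i)" for n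
      using Y(2) by (simp add: u_def gradient_Psi)
    show "(\<lambda>n. u n $ i) \<longlonglongrightarrow> v $ i"
    proof (cases "x $ i = 0")
      case True
      have "u n $ i = v $ i" for n
        unfolding u using True v0[OF True] Y(2)
        by (auto intro!: sum.cong simp: less_imp_le)
      then show ?thesis by simp
    next
      case False
      with x have xi: "0 < x $ i" by (simp add: order_less_le)
      have "x $ i * v $ i = x $ i * (\<Sum>y\<in>Y. c y * (if x $ i \<le> y then 1 else y / x $ i))"
        unfolding v[OF xi] sum_distrib_left using xi by (intro sum.cong) auto
      then have vi: "v $ i = (\<Sum>y\<in>Y. c y * (if x $ i \<le> y then 1 else y / x $ i))"
        using False by simp
      have inv: "(\<lambda>n. inverse (real (Suc n))) \<longlonglongrightarrow> 0" by (rule LIMSEQ_inverse_real_of_nat)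
      have "(\<lambda>n. d * (inverse (real (Suc n)) / x $ i)) \<longlonglongrightarrow> d * (0 / x $ i)"
        by (intro tendsto_intros inv) (use False in auto)
      then have "(\<lambda>n. v $ i + d * (inverse (real (Suc n)) / x $ i)) \<longlonglongrightarrow> v $ i"
        using tendsto_add[OF tendsto_const[of "v $ i"]] by fastforce
      moreover have "eventually (\<lambda>n. v $ i + d * (inverse (real (Suc n)) / x $ i) = u n $ i) sequentially"
        using order_tendstoD(2)[OF inv xi] by eventually_elim (simp add: u vi not_le)
      ultimately show ?thesis by (rule Lim_transform_eventually)
    qed
  qed
  ultimately show ?thesis by (auto simp: closure_sequential)
qed

section \<open>Power series with nonnegative coefficients\<close>

lemma fps_mult_nonneg:
  fixes f g :: "real fps"
  assumes "\<And>n. 0 \<le> fps_nth f n" and "\<And>n. 0 \<le> fps_nth g n"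
  shows "0 \<le> fps_nth (f * g) n"
  by (simp add: fps_mult_nth assms sum_nonneg)

lemma fps_prod_nonneg:
  fixes f :: "'a \<Rightarrow> real fps"
  assumes "\<And>i n. i \<in> I \<Longrightarrow> 0 \<le> fps_nth (f i) n"
  shows "0 \<le> fps_nth (\<Prod>i\<in>I. f i) n"
  using assms
proof (induction I arbitrary: n rule: infinite_finite_induct)
  case (insert i I)
  then show ?case by (auto intro!: fps_mult_nonneg)
qed (simp_all add: fps_one_nth)

text \<open>The degree bound on the factors makes the product a finite sum over all exponent functions with values
  in \<open>{..r}\<close>, so that the constraint \<open>max \<kappa>\<^sub>i \<le> r\<close> in \<^const>\<open>F\<close> is encoded in the factors.\<close>

lemma fps_nth_prod_bounded:
  fixes g :: "'n::finite \<Rightarrow> real fps"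
  assumes "\<And>i j. r < j \<Longrightarrow> fps_nth (g i) j = 0"
  shows "fps_nth (\<Prod>i\<in>UNIV. g i) k =
    (\<Sum>\<kappa> | (\<Sum>i\<in>UNIV. \<kappa> i) = k \<and> Max (range \<kappa>) \<le> r. \<Prod>i\<in>UNIV. fps_nth (g i) (\<kappa> i))"
proof -
  have const_prod: "(\<Prod>i\<in>I. fps_const (a i)) = fps_const (\<Prod>i\<in>I. a i)"
    for a :: "'n \<Rightarrow> real" and I
    by (induction I rule: infinite_finite_induct) (simp_all add: fps_const_mult)
  have g: "g i = (\<Sum>j\<le>r. fps_const (fps_nth (g i) j) * fps_X ^ j)" for i
    using assms by (intro fps_ext) (simp add: fps_sum_nth fps_X_power_nth if_distrib cong: if_cong)
  let ?K = "{\<kappa> :: 'n \<Rightarrow> nat. Max (range \<kappa>) \<le> r}"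
  have K: "Pi\<^sub>E UNIV (\<lambda>_. {..r}) = ?K" by (auto simp: PiE_def)
  have fin: "finite ?K" unfolding K[symmetric] by (intro finite_PiE) auto
  have "(\<Prod>i\<in>UNIV. g i) = (\<Prod>i\<in>UNIV. \<Sum>j\<le>r. fps_const (fps_nth (g i) j) * fps_X ^ j)"
    using g by (rule prod.cong[OF refl])
  also have "\<dots> = (\<Sum>\<kappa>\<in>?K. \<Prod>i\<in>UNIV. fps_const (fps_nth (g i) (\<kappa> i)) * fps_X ^ \<kappa> i)"
    by (subst prod_sum_PiE) (simp_all add: K)
  also have "\<dots> = (\<Sum>\<kappa>\<in>?K. fps_const (\<Prod>i\<in>UNIV. fps_nth (g i) (\<kappa> i)) * fps_X ^ (\<Sum>i\<in>UNIV. \<kappa> i))"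
    by (simp add: prod.distrib const_prod power_sum)
  also have "fps_nth \<dots> k =
      (\<Sum>\<kappa>\<in>?K. if (\<Sum>i\<in>UNIV. \<kappa> i) = k then \<Prod>i\<in>UNIV. fps_nth (g i) (\<kappa> i) else 0)"
    by (auto simp: fps_sum_nth fps_X_power_nth intro!: sum.cong)
  also have "\<dots> = (\<Sum>\<kappa> | (\<Sum>i\<in>UNIV. \<kappa> i) = k \<and> Max (range \<kappa>) \<le> r.
      \<Prod>i\<in>UNIV. fps_nth (g i) (\<kappa> i))"
    using fin by (intro sum.mono_neutral_cong_right) auto
  finally show ?thesis .
qed

section \<open>The truncated exponential\<close>

definition trunc_exp :: "nat \<Rightarrow> real \<Rightarrow> real fps" where
  "trunc_exp r s = Abs_fps (\<lambda>n. if n \<le> r then s ^ n / fact n else 0)"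

lemma trunc_exp_nth: "fps_nth (trunc_exp r s) n = (if n \<le> r then s ^ n / fact n else 0)"
  by (simp add: trunc_exp_def)

lemma trunc_exp_0: "trunc_exp r 0 = 1"
  by (rule fps_ext) (simp add: trunc_exp_nth power_0_left)

lemma trunc_exp_nonneg: "0 \<le> s \<Longrightarrow> 0 \<le> fps_nth (trunc_exp r s) n"
  by (simp add: trunc_exp_nth)

lemma trunc_exp_inverse: "trunc_exp r s * inverse (trunc_exp r s) = 1"
  by (subst mult.commute, rule inverse_mult_eq_1) (simp add: trunc_exp_nth)

lemma deriv_trunc_exp:
  "fps_deriv (trunc_exp r s) =
    fps_const s * trunc_exp r s - fps_const (s ^ Suc r / fact r) * fps_X ^ r"
proof (rule fps_ext)
  fix n
  have "real (Suc n) * (s ^ Suc n / fact (Suc n)) = s * (s ^ n / fact n)"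
    by (simp add: divide_simps del: of_nat_Suc)
  then show "fps_nth (fps_deriv (trunc_exp r s)) n =
      fps_nth (fps_const s * trunc_exp r s - fps_const (s ^ Suc r / fact r) * fps_X ^ r) n"
    by (cases n r rule: linorder_cases)
       (auto simp: trunc_exp_nth fps_X_power_nth simp del: power_Suc fact_Suc of_nat_Suc, simp)
qed

text \<open>The factor \<open>q - p\<close> is antisymmetric under exchanging \<open>p\<close> and \<open>q = N - p\<close>, and \<open>w p * w q\<close> is
  symmetric. Adding the sum to its reversal therefore replaces \<open>E p q\<close> by \<open>E p q - E q p\<close>, which has the
  same sign as \<open>q - p\<close> where the weights do not vanish.\<close>

lemma sum_antisym_nonneg:
  fixes E :: "nat \<Rightarrow> nat \<Rightarrow> real" and w :: "nat \<Rightarrow> real"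
  assumes w: "\<And>p. 0 \<le> w p" and w0: "\<And>p. r < p \<Longrightarrow> w p = 0"
    and E: "\<And>p q. p < q \<Longrightarrow> q \<le> r \<Longrightarrow> E q p \<le> E p q"
  shows "0 \<le> (\<Sum>p=0..N. (real (N - p) - real p) * (w p * w (N - p)) * E p (N - p))" (is "0 \<le> ?S")
proof -
  have rev: "?S = (\<Sum>p=0..N. (real p - real (N - p)) * (w p * w (N - p)) * E (N - p) p)"
    by (subst sum.atLeastAtMost_rev) (auto intro!: sum.cong simp: mult.commute)
  have "2 * ?S = ?S + ?S" by simp
  also have "\<dots> = ?S + (\<Sum>p=0..N. (real p - real (N - p)) * (w p * w (N - p)) * E (N - p) p)"
    using rev by (rule arg_cong)
  also have "\<dots> = (\<Sum>p=0..N. w p * w (N - p) * ((real (N - p) - real p) * (E p (N - p) - E (N - p) p)))"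
    by (simp only: sum.distrib[symmetric]) (simp add: algebra_simps)
  also have "\<dots> \<ge> 0"
  proof (rule sum_nonneg)
    fix p assume "p \<in> {0..N}"
    show "0 \<le> w p * w (N - p) * ((real (N - p) - real p) * (E p (N - p) - E (N - p) p))"
    proof (cases "p \<le> r \<and> N - p \<le> r")
      case True
      have "0 \<le> (real (N - p) - real p) * (E p (N - p) - E (N - p) p)"
        using E[of p "N - p"] E[of "N - p" p] True
        by (cases p "N - p" rule: linorder_cases) (auto intro: mult_nonneg_nonneg mult_nonpos_nonpos)
      then show ?thesis using w by simp
    qed (use w0 in \<open>auto simp: not_le\<close>)
  qed
  finally show ?thesis by simp
qed

text \<open>The Wronskian with respect to the Euler operator \<open>t d/dt\<close> in place of \<open>d/dt\<close>; the extra factor \<open>t\<close>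
  makes its coefficients homogeneous sums over \<open>p + q = N\<close> with weight \<open>q - p\<close>.\<close>

definition euler_wronskian :: "real fps \<Rightarrow> real fps \<Rightarrow> real fps" where
  "euler_wronskian f g = fps_X * (f * fps_deriv g - g * fps_deriv f)"

lemma euler_wronskian_nth:
  "fps_nth (euler_wronskian f g) N =
    (\<Sum>p=0..N. (real (N - p) - real p) * (fps_nth f p * fps_nth g (N - p)))"
proof -
  have theta: "fps_nth (fps_X * fps_deriv h) n = real n * fps_nth h n" for h :: "real fps" and n
    by (cases n) auto
  have "euler_wronskian f g = f * (fps_X * fps_deriv g) - (fps_X * fps_deriv f) * g"
    by (simp add: euler_wronskian_def algebra_simps)
  then have "fps_nth (euler_wronskian f g) N =
     (\<Sum>p=0..N. fps_nth f p * (real (N - p) * fps_nth g (N - p)))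
      - (\<Sum>p=0..N. (real p * fps_nth f p) * fps_nth g (N - p))"
    by (simp only: fps_sub_nth fps_mult_nth[of f "fps_X * fps_deriv g"]
      fps_mult_nth[of "fps_X * fps_deriv f" g] theta)
  then show ?thesis by (simp add: sum_subtractf[symmetric] algebra_simps)
qed

lemma euler_wronskian_trunc_exp_nth:
  "fps_nth (euler_wronskian (trunc_exp r a) (trunc_exp r b)) N =
    (\<Sum>p=0..N. (real (N - p) - real p) *
      ((if p \<le> r then 1 / fact p else 0) * (if N - p \<le> r then 1 / fact (N - p) else 0)) *
      (a ^ p * b ^ (N - p)))"
  unfolding euler_wronskian_nth trunc_exp_nth by (intro sum.cong) auto

lemma power_swap_le:
  fixes a b :: real
  assumes "0 \<le> a" "a \<le> b" "p \<le> q"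
  shows "a ^ q * b ^ p \<le> a ^ p * b ^ q"
proof -
  have "a ^ p * b ^ p * a ^ (q - p) \<le> a ^ p * b ^ p * b ^ (q - p)"
    using assms by (intro mult_left_mono power_mono) auto
  moreover have "z ^ q = z ^ p * z ^ (q - p)" for z :: real
    using assms by (simp add: power_add[symmetric])
  ultimately show ?thesis by (simp add: mult_ac)
qed

lemma euler_wronskian_trunc_exp_nonneg:
  assumes "0 \<le> a" "a \<le> b"
  shows "0 \<le> fps_nth (euler_wronskian (trunc_exp r a) (trunc_exp r b)) N"
  unfolding euler_wronskian_trunc_exp_nth
  by (rule sum_antisym_nonneg[where r = r and E = "\<lambda>p q. a ^ p * b ^ q"
     and w = "\<lambda>p. if p \<le> r then 1 / fact p else 0"])
   (use assms in \<open>auto intro: power_swap_le\<close>)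

section \<open>Generalized Vandermonde determinants and concavity\<close>

text \<open>Divide by \<open>(b - a)(c - a)\<close> to obtain geometric sums \<open>S n z = \<Sum>i<n. a\<^bsup>n-1-i\<^esup> z\<^sup>i\<close>. The first \<open>q\<close> terms
  of \<open>S s\<close> are proportional to \<open>S q\<close> and cancel; the other terms pair \<open>i < q \<le> j\<close>, where
  \<open>b\<^sup>j c\<^sup>i \<le> b\<^sup>i c\<^sup>j\<close>.\<close>

lemma power_increment_ratio:
  fixes a b c :: real
  assumes "0 \<le> a" "a \<le> b" "b \<le> c" "q \<le> s"
  shows "(b ^ s - a ^ s) * (c ^ q - a ^ q) \<le> (b ^ q - a ^ q) * (c ^ s - a ^ s)"
proof -
  define S where "S n z = (\<Sum>i<n. a ^ (n - Suc i) * z ^ i)" for n and z :: real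
  have fac: "z ^ n - a ^ n = (z - a) * S n z" for z n
    unfolding S_def by (rule power_diff_sumr2)
  have "S s b * S q c \<le> S q b * S s c"
  proof -
    have tail: "S s z = a ^ (s - q) * S q z + (\<Sum>j=q..<s. a ^ (s - Suc j) * z ^ j)" for z
    proof -
      have "S s z = (\<Sum>i<q. a ^ (s - Suc i) * z ^ i) + (\<Sum>j=q..<s. a ^ (s - Suc j) * z ^ j)"
        unfolding S_def lessThan_atLeast0 using assms(4)
        by (intro sum.atLeastLessThan_concat[symmetric]) auto
      also have "(\<Sum>i<q. a ^ (s - Suc i) * z ^ i) = a ^ (s - q) * S q z"
        unfolding S_def sum_distrib_left using assms(4)
        by (intro sum.cong) (auto simp: mult.assoc[symmetric] power_add[symmetric])
      finally show ?thesis .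
    qed
    have "(\<Sum>j=q..<s. a ^ (s - Suc j) * b ^ j) * S q c \<le> S q b * (\<Sum>j=q..<s. a ^ (s - Suc j) * c ^ j)"
      unfolding S_def sum_product
    proof (subst sum.swap, intro sum_mono)
      fix i j assume "i \<in> {..<q}" "j \<in> {q..<s}"
      then have "a ^ (s - Suc j) * a ^ (q - Suc i) * (b ^ j * c ^ i)
          \<le> a ^ (s - Suc j) * a ^ (q - Suc i) * (b ^ i * c ^ j)"
        using assms by (intro mult_left_mono power_swap_le) auto
      then show "a ^ (s - Suc j) * b ^ j * (a ^ (q - Suc i) * c ^ i)
          \<le> a ^ (q - Suc i) * b ^ i * (a ^ (s - Suc j) * c ^ j)"
        by (simp add: mult_ac)
    qed
    then show ?thesis unfolding tail by (simp add: algebra_simps)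
  qed
  then have "((b - a) * (c - a)) * (S s b * S q c) \<le> ((b - a) * (c - a)) * (S q b * S s c)"
    using assms by (intro mult_left_mono) auto
  then show ?thesis unfolding fac by (simp add: mult_ac)
qed

text \<open>The expression is the determinant with rows \<open>(z\<^sup>p, z\<^sup>q, z\<^sup>s)\<close> for \<open>z = a, b, c\<close>. Taking out
  \<open>(a b c)\<^sup>p\<close> reduces the smallest exponent to \<open>0\<close>, and subtracting the first row from the others leaves
  the two-by-two determinant of \<open>power_increment_ratio\<close>.\<close>

lemma generalized_vandermonde_nonneg:
  fixes a b c :: real
  assumes "0 \<le> a" "a \<le> b" "b \<le> c" "p \<le> q" "q \<le> s"
  shows "0 \<le> a ^ s * (b ^ p * c ^ q - b ^ q * c ^ p) + c ^ s * (a ^ p * b ^ q - a ^ q * b ^ p)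
    - b ^ s * (a ^ p * c ^ q - a ^ q * c ^ p)"
proof -
  define q' s' where "q' = q - p" and "s' = s - p"
  have [simp]: "q = p + q'" "s = p + s'" "q' \<le> s'" using assms by (auto simp: q'_def s'_def)
  have "0 \<le> (a ^ p * b ^ p * c ^ p) *
      ((b ^ q' - a ^ q') * (c ^ s' - a ^ s') - (b ^ s' - a ^ s') * (c ^ q' - a ^ q'))"
    using assms power_increment_ratio[of a b c q' s'] by (intro mult_nonneg_nonneg) auto
  then show ?thesis by (simp add: power_add algebra_simps)
qed

text \<open>Substituting \<open>f\<^sub>s' = s f\<^sub>s - s\<^bsup>r+1\<^esup> t\<^sup>r / r!\<close>, the terms linear in \<open>s\<close> cancel. What is left still
  contains differences such as \<open>(c - b) f\<^sub>b f\<^sub>c\<close>; reading the same identity backwards turns them into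
  Wronskians, and the resulting corrections cancel as well. Hence \<open>t\<close> times the expression is \<open>t\<^sup>r / r!\<close> times
  a combination \<open>V\<close> of three Wronskians, whose coefficients are sums of three-by-three determinants.\<close>

lemma trunc_exp_concavity:
  assumes "0 \<le> a" "a \<le> b" "b \<le> c"
  shows "0 \<le> fps_nth (fps_const (c - a) * fps_deriv (trunc_exp r b) * trunc_exp r a * trunc_exp r c
    - fps_const (c - b) * fps_deriv (trunc_exp r a) * trunc_exp r b * trunc_exp r c
    - fps_const (b - a) * fps_deriv (trunc_exp r c) * trunc_exp r a * trunc_exp r b) N"
    (is "0 \<le> fps_nth ?D N")
proof -
  define fa fb fc where f: "fa = trunc_exp r a" "fb = trunc_exp r b" "fc = trunc_exp r c"
  define A B C where ABC: "A = fps_const (a ^ Suc r)" "B = fps_const (b ^ Suc r)" "C = fps_const (c ^ Suc r)"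
  define u where "u = fps_const (1 / fact r :: real) * fps_X ^ r"
  define a' b' c' where abc: "a' = fps_const a" "b' = fps_const b" "c' = fps_const c"
  define V where "V = A * euler_wronskian fb fc + C * euler_wronskian fa fb - B * euler_wronskian fa fc"
  have u: "fps_const (s ^ Suc r / fact r) * fps_X ^ r = u * fps_const (s ^ Suc r)" for s :: real
  proof -
    have "fps_const (s ^ Suc r / fact r) = fps_const (1 / fact r) * fps_const (s ^ Suc r)"
      unfolding fps_const_mult by simp
    then show ?thesis unfolding u_def by (simp only: mult_ac)
  qed
  have d: "fps_deriv fa = a' * fa - u * A" "fps_deriv fb = b' * fb - u * B" "fps_deriv fc = c' * fc - u * C"
    unfolding f ABC abc deriv_trunc_exp u by (rule refl)+
  have diff: "fps_const (c - a) = c' - a'" "fps_const (c - b) = c' - b'" "fps_const (b - a) = b' - a'"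
    by (simp_all add: abc)
  have "fps_X * ?D = u * V"
    unfolding V_def euler_wronskian_def diff f[symmetric] d by (simp add: algebra_simps)
  have V: "0 \<le> fps_nth V n" for n
  proof -
    let ?E = "\<lambda>p q. a ^ Suc r * (b ^ p * c ^ q) + c ^ Suc r * (a ^ p * b ^ q) - b ^ Suc r * (a ^ p * c ^ q)"
    have "fps_nth V n = (\<Sum>p=0..n. (real (n - p) - real p) *
      ((if p \<le> r then 1 / fact p else 0) * (if n - p \<le> r then 1 / fact (n - p) else 0)) *
      ?E p (n - p))"
      unfolding V_def ABC f fps_sub_nth fps_add_nth fps_mult_left_const_nth euler_wronskian_trunc_exp_nth
        sum_distrib_left sum.distrib[symmetric] sum_subtractf[symmetric]
      by (intro sum.cong refl) (simp only: algebra_simps)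
    also have "\<dots> \<ge> 0"
    proof (rule sum_antisym_nonneg[where r = r and E = ?E
        and w = "\<lambda>p. if p \<le> r then 1 / fact p else 0"])
      fix p q :: nat assume "p < q" "q \<le> r"
      then show "?E q p \<le> ?E p q"
        using generalized_vandermonde_nonneg[OF assms, of p q "Suc r"] by (simp add: algebra_simps)
    qed auto
    finally show ?thesis .
  qed
  have "fps_nth ?D N = fps_nth (fps_X * ?D) (Suc N)" by simp
  also have "\<dots> = fps_nth (u * V) (Suc N)" using \<open>fps_X * ?D = u * V\<close> by simp
  also have "\<dots> \<ge> 0"
    by (rule fps_mult_nonneg[OF _ V]) (simp add: u_def fps_X_power_nth)
  finally show ?thesis .
qed

section \<open>The partial derivatives as a concave function of the coordinates\<close>

definition gen_prod :: "nat \<Rightarrow> real ^ 'n \<Rightarrow> real fps" where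
  "gen_prod r x = (\<Prod>i\<in>UNIV. trunc_exp r (x $ i))"

text \<open>The partial derivative of \<open>F\<^bsub>m+1,r\<^esub>\<close> in a coordinate of value \<open>s\<close>. It is defined for every
  \<open>s\<close>, so that coordinates of equal value visibly have equal derivatives and the point \<open>0\<close> is available
  even if no coordinate vanishes.\<close>

definition slope_at :: "nat \<Rightarrow> nat \<Rightarrow> real ^ 'n \<Rightarrow> real \<Rightarrow> real" where
  "slope_at m r x s = fps_nth (gen_prod r x -
    fps_const (s ^ r / fact r) * (fps_X ^ r * (gen_prod r x * inverse (trunc_exp r s)))) m"

text \<open>Differentiating the \<open>i\<close>-th factor of a monomial of \<^const>\<open>F\<close> replaces the weight \<open>s\<^sup>n/n!\<close> by
  \<open>s\<^bsup>n-1\<^esup>/(n-1)!\<close>, that is, the \<open>i\<close>-th factor of the product of truncated exponentials by the series \<open>T\<close>: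
  one degree is gained by the shift and the top term is lost. Reassembling the coefficients, with the
  remaining factors written as the full product divided by the \<open>i\<close>-th one, gives the formula.\<close>

lemma gradient_F:
  fixes x :: "real ^ 'n"
  shows "gradient (F (Suc m) r) x $ i = slope_at m r x (x $ i)"
proof -
  let ?K = "{\<kappa> :: 'n \<Rightarrow> nat. (\<Sum>i\<in>UNIV. \<kappa> i) = Suc m \<and> Max (range \<kappa>) \<le> r}"
  define T where "T s = fps_X * (trunc_exp r s - fps_const (s ^ r / fact r) * fps_X ^ r)" for s
  define G where "G i j = (if j = i then T (x $ j) else trunc_exp r (x $ j))" for i j
  have T: "fps_nth (T s) n = (if n \<le> r then real n * s ^ (n - 1) / fact n else 0)" for s n
  proof (cases n)
    case (Suc l)
    have "real (Suc l) * s ^ l / fact (Suc l) = s ^ l / fact l"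
      by (simp add: divide_simps del: of_nat_Suc)
    then show ?thesis unfolding T_def Suc
      by (cases l r rule: linorder_cases)
         (auto simp: trunc_exp_nth fps_X_power_nth simp del: fact_Suc of_nat_Suc)
  qed (simp add: T_def)
  have pw: "((\<lambda>x. (x $ j) ^ n / fact n) has_derivative
      (\<lambda>h. h $ j * (real n * (x $ j) ^ (n - 1) / fact n))) (at x)" for j n
  proof -
    have "((\<lambda>s. s ^ n / fact n) has_field_derivative (real n * (x $ j) ^ (n - 1) / fact n)) (at (x $ j))"
      by (auto intro!: derivative_eq_intros)
    from diff_chain_at[OF bounded_linear_imp_has_derivative[OF bounded_linear_vec_nth[of j], of "at x"]
        this[unfolded has_field_derivative_def]]
    show ?thesis by (simp add: o_def mult.commute)
  qed
  have "((\<lambda>x. \<Prod>j\<in>UNIV. (x $ j) ^ \<kappa> j / fact (\<kappa> j)) has_derivative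
      (\<lambda>h. \<Sum>i\<in>UNIV. h $ i * (\<Prod>j\<in>UNIV. fps_nth (G i j) (\<kappa> j)))) (at x)"
    if \<kappa>: "\<kappa> \<in> ?K" for \<kappa>
  proof -
    have le: "\<kappa> j \<le> r" for j using \<kappa> by auto
    have split: "(\<Prod>j\<in>UNIV. fps_nth (G i j) (\<kappa> j)) =
      (real (\<kappa> i) * (x $ i) ^ (\<kappa> i - 1) / fact (\<kappa> i)) *
        (\<Prod>j\<in>UNIV - {i}. (x $ j) ^ \<kappa> j / fact (\<kappa> j))" for i
      by (subst prod.remove[of _ i])
         (auto simp: G_def T le trunc_exp_nth intro!: arg_cong2[where f = "(*)"] prod.cong)
    have "((\<lambda>x. \<Prod>j\<in>UNIV. (x $ j) ^ \<kappa> j / fact (\<kappa> j)) has_derivative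
      (\<lambda>h. \<Sum>i\<in>UNIV. (h $ i * (real (\<kappa> i) * (x $ i) ^ (\<kappa> i - 1) / fact (\<kappa> i))) *
        (\<Prod>j\<in>UNIV - {i}. (x $ j) ^ \<kappa> j / fact (\<kappa> j)))) (at x)"
      by (rule has_derivative_prod) (rule pw)
    then show ?thesis by (simp only: split mult.assoc)
  qed
  then have "(F (Suc m) r has_derivative
      (\<lambda>h. \<Sum>\<kappa>\<in>?K. \<Sum>i\<in>UNIV. h $ i * (\<Prod>j\<in>UNIV. fps_nth (G i j) (\<kappa> j)))) (at x)"
    unfolding F_def[abs_def] by (rule has_derivative_sum)
  moreover have "(\<Sum>\<kappa>\<in>?K. \<Sum>i\<in>UNIV. h $ i * (\<Prod>j\<in>UNIV. fps_nth (G i j) (\<kappa> j))) =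
      h \<bullet> (\<chi> i. fps_nth (\<Prod>j\<in>UNIV. G i j) (Suc m))" for h
  proof -
    have "fps_nth (\<Prod>j\<in>UNIV. G i j) (Suc m) = (\<Sum>\<kappa>\<in>?K. \<Prod>j\<in>UNIV. fps_nth (G i j) (\<kappa> j))" for i
      by (rule fps_nth_prod_bounded) (simp add: G_def T trunc_exp_nth)
    then show ?thesis
      by (subst sum.swap) (simp add: inner_vec_def sum_distrib_left)
  qed
  ultimately have "gradient (F (Suc m) r) x = (\<chi> i. fps_nth (\<Prod>j\<in>UNIV. G i j) (Suc m))"
    by (intro gradient_eqI) (simp add: gderiv_def)
  then have "gradient (F (Suc m) r) x $ i = fps_nth (\<Prod>j\<in>UNIV. G i j) (Suc m)" by simp
  also have "(\<Prod>j\<in>UNIV. G i j) = T (x $ i) * (\<Prod>j\<in>UNIV - {i}. trunc_exp r (x $ j))"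
    by (subst prod.remove[of _ i]) (auto simp: G_def intro!: arg_cong2[where f = "(*)"] prod.cong)
  also have "(\<Prod>j\<in>UNIV - {i}. trunc_exp r (x $ j)) = gen_prod r x * inverse (trunc_exp r (x $ i))"
    unfolding gen_prod_def
    by (subst (2) prod.remove[of _ i]) (simp_all add: trunc_exp_inverse mult.commute mult.left_commute)
  also have "T (x $ i) * \<dots> = fps_X * (gen_prod r x * (trunc_exp r (x $ i) * inverse (trunc_exp r (x $ i)))
      - fps_const ((x $ i) ^ r / fact r) * (fps_X ^ r * (gen_prod r x * inverse (trunc_exp r (x $ i)))))"
    unfolding T_def by (simp only: algebra_simps)
  finally show ?thesis by (simp add: trunc_exp_inverse slope_at_def)
qed

text \<open>Each nonzero element of \<open>A\<close> is the value of some coordinate, and distinct values use distinct factors of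
  the product. The point \<open>0\<close> costs no factor because its truncated exponential is \<open>1\<close>.\<close>

lemma gen_prod_factor:
  fixes x :: "real ^ 'n"
  assumes "\<And>i. 0 \<le> x $ i" and A: "A \<subseteq> insert 0 (range (($) x))"
  shows "\<exists>Q. (\<forall>n. 0 \<le> fps_nth Q n) \<and> gen_prod r x = Q * (\<Prod>a\<in>A. trunc_exp r a)"
proof -
  have fin: "finite A" using A by (rule finite_subset) simp
  have "\<forall>a\<in>A - {0}. \<exists>i. x $ i = a" using A by auto
  then obtain idx where idx: "\<And>a. a \<in> A - {0} \<Longrightarrow> x $ idx a = a" by metis
  define I where "I = idx ` (A - {0})"
  have inj: "inj_on idx (A - {0})" by (rule inj_onI) (metis idx)
  have "(\<Prod>a\<in>A. trunc_exp r a) = (\<Prod>a\<in>A - {0}. trunc_exp r a)"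
    using fin by (intro prod.mono_neutral_right) (auto simp: trunc_exp_0)
  also have "\<dots> = (\<Prod>i\<in>I. trunc_exp r (x $ i))"
    unfolding I_def prod.reindex[OF inj] using idx by (intro prod.cong) auto
  finally have "gen_prod r x = (\<Prod>i\<in>UNIV - I. trunc_exp r (x $ i)) * (\<Prod>a\<in>A. trunc_exp r a)"
    unfolding gen_prod_def by (simp add: prod.subset_diff[of I UNIV])
  moreover have "0 \<le> fps_nth (\<Prod>i\<in>UNIV - I. trunc_exp r (x $ i)) n" for n
    using assms(1) by (intro fps_prod_nonneg trunc_exp_nonneg)
  ultimately show ?thesis by blast
qed

text \<open>Multiplication by \<open>s\<close> turns the formula for the partial derivative into a logarithmic derivative in the
  series variable, which is what makes Wronskians appear in the comparison of different points.\<close>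

lemma mult_slope_at:
  "s * slope_at m r x s =
    fps_nth (gen_prod r x * inverse (trunc_exp r s) * fps_deriv (trunc_exp r s)) m"
proof -
  have "gen_prod r x * inverse (trunc_exp r s) * fps_deriv (trunc_exp r s) =
     fps_const s * gen_prod r x * (trunc_exp r s * inverse (trunc_exp r s))
     - fps_const (s ^ Suc r / fact r) * (fps_X ^ r * (gen_prod r x * inverse (trunc_exp r s)))"
    unfolding deriv_trunc_exp by (simp only: algebra_simps)
  also have "\<dots> = fps_const s * (gen_prod r x
     - fps_const (s ^ r / fact r) * (fps_X ^ r * (gen_prod r x * inverse (trunc_exp r s))))"
    by (simp add: trunc_exp_inverse right_diff_distrib mult.assoc[symmetric] fps_const_mult)
  finally show ?thesis by (simp add: slope_at_def)
qed

lemma mult_slope_at_mono: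
  fixes x :: "real ^ 'n"
  assumes x: "\<And>i. 0 \<le> x $ i" and ab: "a \<in> insert 0 (range (($) x))" "b \<in> insert 0 (range (($) x))" "a < b"
  shows "a * slope_at m r x a \<le> b * slope_at m r x b"
proof -
  define fa fb where f: "fa = trunc_exp r a" "fb = trunc_exp r b"
  have inv: "fa * inverse fa = 1" "fb * inverse fb = 1" unfolding f by (rule trunc_exp_inverse)+
  obtain Q where Q: "\<And>n. 0 \<le> fps_nth Q n" and P: "gen_prod r x = Q * (fa * fb)"
    using gen_prod_factor[OF x, of "{a, b}" r] ab unfolding f by auto
  have quot: "gen_prod r x * inverse fa = Q * fb" "gen_prod r x * inverse fb = Q * fa"
    unfolding P using inv by (simp_all add: mult.assoc mult.left_commute)
  have "0 \<le> a" using ab x by auto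
  have W: "0 \<le> fps_nth (fa * fps_deriv fb - fb * fps_deriv fa) n" for n
  proof -
    have "0 \<le> fps_nth (euler_wronskian fa fb) (Suc n)"
      unfolding f using \<open>0 \<le> a\<close> ab(3) by (intro euler_wronskian_trunc_exp_nonneg) auto
    then show ?thesis unfolding euler_wronskian_def by simp
  qed
  have "b * slope_at m r x b - a * slope_at m r x a =
      fps_nth (Q * fa * fps_deriv fb - Q * fb * fps_deriv fa) m"
    unfolding mult_slope_at f[symmetric] quot by simp
  also have "Q * fa * fps_deriv fb - Q * fb * fps_deriv fa = Q * (fa * fps_deriv fb - fb * fps_deriv fa)"
    by (simp add: algebra_simps)
  also have "0 \<le> fps_nth \<dots> m" using Q W by (rule fps_mult_nonneg)
  finally show ?thesis by simp
qed

lemma mult_slope_at_concave: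
  fixes x :: "real ^ 'n"
  assumes x: "\<And>i. 0 \<le> x $ i"
    and abc: "a \<in> insert 0 (range (($) x))" "b \<in> insert 0 (range (($) x))" "c \<in> insert 0 (range (($) x))"
      "a < b" "b < c"
  shows "(c - b) * (a * slope_at m r x a) + (b - a) * (c * slope_at m r x c)
    \<le> (c - a) * (b * slope_at m r x b)"
proof -
  define fa fb fc where f: "fa = trunc_exp r a" "fb = trunc_exp r b" "fc = trunc_exp r c"
  have inv: "fa * inverse fa = 1" "fb * inverse fb = 1" "fc * inverse fc = 1"
    unfolding f by (rule trunc_exp_inverse)+
  have "\<exists>Q. (\<forall>n. 0 \<le> fps_nth Q n) \<and> gen_prod r x = Q * (\<Prod>a\<in>{a, b, c}. trunc_exp r a)"
    by (rule gen_prod_factor[OF x]) (use abc in auto)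
  then obtain Q where Q: "\<And>n. 0 \<le> fps_nth Q n" and P: "gen_prod r x = Q * (fa * (fb * fc))"
    using abc(4,5) unfolding f by auto
  have "gen_prod r x * inverse fa = Q * (fb * fc) * (fa * inverse fa)"
    "gen_prod r x * inverse fb = Q * (fa * fc) * (fb * inverse fb)"
    "gen_prod r x * inverse fc = Q * (fa * fb) * (fc * inverse fc)"
    unfolding P by (simp_all only: mult_ac)
  then have quot: "gen_prod r x * inverse fa = Q * (fb * fc)" "gen_prod r x * inverse fb = Q * (fa * fc)"
    "gen_prod r x * inverse fc = Q * (fa * fb)"
    unfolding inv by simp_all
  have "0 \<le> a" using abc x by auto
  let ?D = "fps_const (c - a) * fps_deriv fb * fa * fc
    - fps_const (c - b) * fps_deriv fa * fb * fc - fps_const (b - a) * fps_deriv fc * fa * fb"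
  have "(c - a) * (b * slope_at m r x b) - (c - b) * (a * slope_at m r x a)
      - (b - a) * (c * slope_at m r x c) =
      fps_nth (fps_const (c - a) * (Q * (fa * fc) * fps_deriv fb)
        - fps_const (c - b) * (Q * (fb * fc) * fps_deriv fa)
        - fps_const (b - a) * (Q * (fa * fb) * fps_deriv fc)) m"
    unfolding mult_slope_at f[symmetric] quot by (simp only: fps_sub_nth fps_mult_left_const_nth)
  also have "fps_const (c - a) * (Q * (fa * fc) * fps_deriv fb)
        - fps_const (c - b) * (Q * (fb * fc) * fps_deriv fa)
        - fps_const (b - a) * (Q * (fa * fb) * fps_deriv fc) = Q * ?D"
    by (simp only: right_diff_distrib mult_ac)
  also have "0 \<le> fps_nth \<dots> m"
    unfolding f using Q \<open>0 \<le> a\<close> abc(4,5) by (intro fps_mult_nonneg trunc_exp_concavity) auto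
  finally show ?thesis by simp
qed

lemma slope_at_0: "1 \<le> r \<Longrightarrow> slope_at m r x 0 = fps_nth (gen_prod r x) m"
  by (simp add: slope_at_def power_0_left)

text \<open>The term subtracted in the slope at \<open>s\<close> is \<open>s\<^sup>r t\<^sup>r / r!\<close> times the product over the other coordinates,
  which has nonnegative coefficients, and it vanishes at \<open>s = 0\<close>. This will bound the total mass of the
  truncations.\<close>

lemma slope_at_le_slope_at_0:
  fixes x :: "real ^ 'n"
  assumes x: "\<And>i. 0 \<le> x $ i" and s: "s \<in> range (($) x)" and "1 \<le> r"
  shows "slope_at m r x s \<le> slope_at m r x 0"
proof -
  obtain Q where Q: "\<And>n. 0 \<le> fps_nth Q n" and P: "gen_prod r x = Q * trunc_exp r s"
    using gen_prod_factor[OF x, of "{s}" r] s by auto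
  have quot: "gen_prod r x * inverse (trunc_exp r s) = Q"
    unfolding P by (simp add: mult.assoc trunc_exp_inverse)
  have "0 \<le> s" using s x by auto
  then have "0 \<le> s ^ r / fact r * fps_nth (fps_X ^ r * Q) m"
    by (intro mult_nonneg_nonneg fps_mult_nonneg Q) (simp_all add: fps_X_power_nth)
  then show ?thesis
    unfolding slope_at_0[OF \<open>1 \<le> r\<close>] unfolding slope_at_def quot by simp
qed

lemma slope_at_0_nonneg:
  fixes x :: "real ^ 'n"
  assumes "\<And>i. 0 \<le> x $ i" and "1 \<le> r"
  shows "0 \<le> slope_at m r x 0"
  unfolding slope_at_0[OF assms(2)] gen_prod_def
  by (intro fps_prod_nonneg trunc_exp_nonneg assms(1))

theorem corollary14:
  fixes x :: "real ^ 'n" and k r :: nat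
  assumes "\<And>i. x $ i \<ge> 0" and "k \<ge> 1" and "r \<ge> 1"
  shows "gradient (F k r) x \<in> closure (C_Psi x)"
proof -
  obtain m where k: "k = Suc m" using assms(2) by (cases k) auto
  let ?g = "slope_at m r x"
  define Y where "Y = range (($) x) - {0}"
  have Y: "finite Y" "\<And>y. y \<in> Y \<Longrightarrow> 0 < y"
    using assms(1) by (auto simp: Y_def order_less_le)
  have Y0: "insert 0 Y = insert 0 (range (($) x))" by (auto simp: Y_def)
  have "\<exists>c. (\<forall>y\<in>Y. 0 \<le> c y) \<and> (\<forall>s\<in>Y. s * ?g s = (\<Sum>y\<in>Y. c y * min s y))"
  proof (rule concave_as_sum_of_truncations)
    fix a b assume "a \<in> insert 0 Y" "b \<in> insert 0 Y" "a < b"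
    then show "a * ?g a \<le> b * ?g b" unfolding Y0 by (rule mult_slope_at_mono[OF assms(1)])
  next
    fix a b c assume "a \<in> insert 0 Y" "b \<in> insert 0 Y" "c \<in> insert 0 Y" "a < b" "b < c"
    then show "(c - b) * (a * ?g a) + (b - a) * (c * ?g c) \<le> (c - a) * (b * ?g b)"
      unfolding Y0 by (rule mult_slope_at_concave[OF assms(1)])
  qed (use Y in auto)
  then obtain c where c: "\<And>y. y \<in> Y \<Longrightarrow> 0 \<le> c y"
    and h: "\<And>s. s \<in> Y \<Longrightarrow> s * ?g s = (\<Sum>y\<in>Y. c y * min s y)"
    by blast
  have total: "(\<Sum>y\<in>Y. c y) \<le> ?g 0"
  proof (cases "Y = {}")
    case True
    then show ?thesis using slope_at_0_nonneg[OF assms(1,3)] by simp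
  next
    case False
    \<comment> \<open>No truncation has taken effect at the smallest point, so the slope there is the total mass.\<close>
    define y where "y = Min Y"
    have y: "y \<in> Y" "\<And>z. z \<in> Y \<Longrightarrow> y \<le> z" using Y(1) False by (auto simp: y_def)
    have "y * ?g y = y * (\<Sum>y\<in>Y. c y)"
      unfolding h[OF y(1)] sum_distrib_left using y(2) by (intro sum.cong) (auto simp: min_def)
    then have "?g y = (\<Sum>y\<in>Y. c y)" using Y(2)[OF y(1)] by simp
    then show ?thesis
      using slope_at_le_slope_at_0[OF assms(1) _ assms(3), of y m] y(1) by (auto simp: Y_def)
  qed
  show ?thesis
    unfolding k
  proof (rule in_closure_C_Psi[OF assms(1) Y c, where d = "?g 0 - (\<Sum>y\<in>Y. c y)"])
    fix i
    show "x $ i * gradient (F (Suc m) r) x $ i = (\<Sum>y\<in>Y. c y * min (x $ i) y)" if "0 < x $ i"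
      unfolding gradient_F using that by (intro h) (simp add: Y_def)
    show "gradient (F (Suc m) r) x $ i = (\<Sum>y\<in>Y. c y) + (?g 0 - (\<Sum>y\<in>Y. c y))" if "x $ i = 0"
      unfolding gradient_F that by simp
  qed (use total in simp_all)
qed

end
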